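(* Let $N_R\ge 1$ and $\eta\ge 1$ be integers and let $\rho\in(0,1)$. Among all feasible weight vectors $\mathbf{w}=(w_1,\dots,w_{N_R})$, i.e. real vectors with $\sum_{j=1}^{N_R} w_j=1$ and $w_j\ge 0$ for all $j\in\{1,\dots,N_R\}$, the equal-weight assignment $w_j=1/N_R$ for all $j$ yields the minimum of the multi-antenna false-alarm probability $$P_{FA}^M(\mathbf{w})=Q\left(\sqrt{\frac{2\eta}{1+\rho^2}}\cdot\frac{\rho\sum_{j=1}^{N_R}w_j}{\sqrt{\sum_{j=1}^{N_R}w_j^2}}\right).$$
   Context: $Q(x)=\frac{1}{\sqrt{2\pi}}\int_x^\infty e^{-z^2/2}\,dz$ is the Gaussian Q-function. Setting: a receiver has $N_R$ antennas; $\eta$ is the length of a short training sequence and $\rho$ is the packet-detection threshold. When there is no packet (noise only), the (noise-normalized) compensated autocorrelation at antenna $j$ is modelled as a Gaussian random variable $r_{N,j}\sim N\left(-\rho,\ \frac{1+\rho^2}{2\eta}\right)$, independent across antennas. The receiver forms the weighted sum $r_N^M=\sum_{j=1}^{N_R}w_j r_{N,j}$, and a false alarm is the event $r_N^M>0$; its probability under this model is the $P_{FA}^M(\mathbf{w})$ displayed in the claim. *)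

theory Defs
  imports "HOL-Analysis.Analysis"
begin

definition gaussian_Q :: "real \<Rightarrow> real" where
  "gaussian_Q x = 1 / sqrt (2 * pi) * (LBINT z:{x..}. exp (- z\<^sup>2 / 2))"

text \<open>
  Weight vectors with \<open>n\<close> entries are functions \<open>w :: nat \<Rightarrow> real\<close> of which only the values on
  \<open>{1..n}\<close> matter.
\<close>

definition feasible_weights :: "nat \<Rightarrow> (nat \<Rightarrow> real) \<Rightarrow> bool" where
  "feasible_weights n w \<longleftrightarrow> (\<Sum>j=1..n. w j) = 1 \<and> (\<forall>j\<in>{1..n}. 0 \<le> w j)"

text \<open>
  The probability that \<open>\<Sum>j=1..n. w j * r j\<close> is positive, when the \<open>r j\<close> are independent
  Gaussians with mean \<open>- \<rho>\<close> and variance \<open>(1 + \<rho>\<^sup>2) / (2 * \<eta>)\<close>, in closed form.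
\<close>

definition false_alarm_prob :: "nat \<Rightarrow> nat \<Rightarrow> real \<Rightarrow> (nat \<Rightarrow> real) \<Rightarrow> real" where
  "false_alarm_prob n \<eta> \<rho> w =
     gaussian_Q (sqrt (2 * real \<eta> / (1 + \<rho>\<^sup>2)) *
       (\<rho> * (\<Sum>j=1..n. w j) / sqrt (\<Sum>j=1..n. (w j)\<^sup>2)))"

end

theory Submission
  imports Defs "HOL-Probability.Distributions"
begin

text \<open>On feasible vectors the weights sum to 1, so the argument of Q is a nonnegative constant
  times \<rho> divided by the Euclidean norm of \<open>w\<close>. Q is decreasing
  (\<open>antimono_gaussian_Q\<close>), so minimizing the false-alarm probability amounts to
  minimizing that norm. By Cauchy-Schwarz (\<open>inverse_card_le_sum_squares\<close>) the squared
  norm is at least 1/n for n weights, and equal weights attain this bound.\<close>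

lemma set_integrable_gaussian:
  fixes A :: "real set"
  assumes "A \<in> sets lborel"
  shows "set_integrable lborel A (\<lambda>z. exp (- z\<^sup>2 / 2))"
proof -
  have "integrable lborel (\<lambda>z. sqrt (2 * pi) * std_normal_density z)"
    using integrable_normal_density[of 1 0] by simp
  then have "integrable lborel (\<lambda>z :: real. exp (- z\<^sup>2 / 2))"
    by (simp add: std_normal_density_def)
  then have "set_integrable lborel UNIV (\<lambda>z :: real. exp (- z\<^sup>2 / 2))"
    by (simp add: set_integrable_def)
  then show ?thesis
    by (rule set_integrable_subset) (use assms in auto)
qed

text \<open>Raising the lower limit shrinks the domain of integration of a positive
  integrand.\<close>

lemma antimono_gaussian_Q: "antimono gaussian_Q"
proof (rule antimonoI)
  fix x y :: real
  assume "x \<le> y"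
  have "(LBINT z:{y..}. exp (- z\<^sup>2 / 2)) \<le> (LBINT z:{x..}. exp (- z\<^sup>2 / 2))"
    unfolding set_lebesgue_integral_def
  proof (rule integral_mono)
    \<comment> \<open>Without integrability the integrals would default to 0 and pointwise
      comparison would say nothing.\<close>
    show "integrable lborel (\<lambda>z. indicat_real {y..} z *\<^sub>R exp (- z\<^sup>2 / 2))"
      "integrable lborel (\<lambda>z. indicat_real {x..} z *\<^sub>R exp (- z\<^sup>2 / 2))"
      using set_integrable_gaussian by (auto simp: set_integrable_def)
  qed (use \<open>x \<le> y\<close> in \<open>auto simp: indicator_def\<close>)
  then show "gaussian_Q y \<le> gaussian_Q x"
    unfolding gaussian_Q_def by (intro mult_left_mono) auto
qed

text \<open>Cauchy-Schwarz applied to \<open>w\<close> and the all-ones vector on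
  \<open>I\<close>.\<close>

lemma inverse_card_le_sum_squares:
  fixes w :: "'a \<Rightarrow> real"
  assumes "(\<Sum>j\<in>I. w j) = 1"
  shows "1 / card I \<le> (\<Sum>j\<in>I. (w j)\<^sup>2)"
proof -
  \<comment> \<open>Sums over empty or infinite sets are 0, which contradicts the total 1.\<close>
  have "finite I" "I \<noteq> {}"
    using assms sum.infinite by fastforce+
  then have "card I > 0"
    by (simp add: card_gt_0_iff)
  then show ?thesis
    using sum_squared_le_sum_of_squares[of w I] assms by (simp add: divide_le_eq)
qed

theorem proposition1:
  fixes N\<^sub>R \<eta> :: nat and \<rho> :: real
  assumes "N\<^sub>R \<ge> 1" and "\<eta> \<ge> 1" and "0 < \<rho>" and "\<rho> < 1"
  shows "is_arg_min (false_alarm_prob N\<^sub>R \<eta> \<rho>) (feasible_weights N\<^sub>R) (\<lambda>j. 1 / real N\<^sub>R)"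
proof -
  let ?u = "\<lambda>j :: nat. 1 / real N\<^sub>R"
  have u: "(\<Sum>j=1..N\<^sub>R. ?u j) = 1" "(\<Sum>j=1..N\<^sub>R. (?u j)\<^sup>2) = 1 / N\<^sub>R"
    using assms(1) by (simp_all add: power2_eq_square)
  have "false_alarm_prob N\<^sub>R \<eta> \<rho> ?u \<le> false_alarm_prob N\<^sub>R \<eta> \<rho> w" if "feasible_weights N\<^sub>R w" for w
  proof -
    have w: "(\<Sum>j=1..N\<^sub>R. w j) = 1"
      using that by (simp add: feasible_weights_def)
    then have "1 / N\<^sub>R \<le> (\<Sum>j=1..N\<^sub>R. (w j)\<^sup>2)"
      using inverse_card_le_sum_squares[of w "{1..N\<^sub>R}"] by simp
    \<comment> \<open>Together with the lower bound 1/n this makes the sum of squares positive, so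
      both square roots are genuine positive denominators.\<close>
    moreover have "0 < 1 / real N\<^sub>R"
      using assms(1) by simp
    ultimately have "\<rho> / sqrt (\<Sum>j=1..N\<^sub>R. (w j)\<^sup>2) \<le> \<rho> / sqrt (1 / N\<^sub>R)"
      using assms(3) by (intro divide_left_mono mult_pos_pos) (auto simp del: zero_less_divide_1_iff intro: less_le_trans)
    then show ?thesis
      unfolding false_alarm_prob_def u w
      by (intro antimonoD[OF antimono_gaussian_Q] mult_left_mono) auto
  qed
  moreover have "feasible_weights N\<^sub>R ?u"
    using u(1) by (simp add: feasible_weights_def)
  ultimately show ?thesis
    by (auto simp: is_arg_min_def not_less)
qed

end
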